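(* There exist an integer $n_0$ and a function $h:\mathbb{N}\to\mathbb{N}$ such that for all integers $n\ge n_0$ and $T\ge h(n)$ the following holds. Let $V$ be a set of $n$ items. For every (possibly randomized) online ranking algorithm for the single choice setting, there is a sequence $u_1,\dots,u_T\in V$ for which the expected total regret of the algorithm after $T$ steps, $$\mathbb{E}\Big[\sum_{t=1}^T \big(\pi_t(u_t)-1\big)\Big]-\min_{\pi\in S(V)}\sum_{t=1}^T\big(\pi(u_t)-1\big),$$ is at least $0.003\cdot n^{3/2}\sqrt{T}$. In other words, the minimax expected total regret in the single choice case after $T$ steps is at least $0.003\cdot n^{3/2}\sqrt{T}$.
   Context: A ranking of $V$ is a bijection $\pi:V\to\{1,\dots,n\}$, and $S(V)$ is the set of rankings. In the single choice setting, at each step $t=1,\dots,T$ the algorithm outputs a ranking $\pi_t\in S(V)$, possibly at random and depending on $n,T$, its past outputs and $u_1,\dots,u_{t-1}$; then $u_t\in V$ is revealed and the algorithm incurs loss $\pi_t(u_t)-1$ (loss $0$ if $u_t$ is in first position, $1$ if in second position, etc.). Expectation is over the algorithm's internal randomness. *)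

theory Defs
  imports "HOL-Probability.Probability"
begin

type_synonym 'v ranking = "'v \<Rightarrow> nat"

text \<open>Rankings are extensional (\<^term>\<open>undefined\<close> outside \<open>V\<close>), so that they correspond one-to-one
  to the bijections from \<open>V\<close> onto \<open>{1..card V}\<close>; for finite \<open>V\<close> there are finitely many.\<close>

definition rankings :: "'v set \<Rightarrow> 'v ranking set" where
  "rankings V = {\<pi> \<in> extensional V. bij_betw \<pi> V {1..card V}}"

text \<open>A randomized algorithm maps the items \<open>[u\<^sub>1, \<dots>, u\<^sub>t]\<close> revealed so far and its own outputs
  \<open>[\<pi>\<^sub>1, \<dots>, \<pi>\<^sub>t]\<close> so far to the conditional distribution of its next output. Both lists are in
  chronological order.\<close>

type_synonym 'v algorithm = "'v list \<Rightarrow> 'v ranking list \<Rightarrow> 'v ranking pmf"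

definition online_algorithms :: "'v set \<Rightarrow> nat \<Rightarrow> 'v algorithm set" where
  "online_algorithms V T = {A. \<forall>us \<pi>s. set us \<subseteq> V \<longrightarrow> set \<pi>s \<subseteq> rankings V \<longrightarrow>
     length us < T \<longrightarrow> length \<pi>s = length us \<longrightarrow> set_pmf (A us \<pi>s) \<subseteq> rankings V}"

text \<open>Joint distribution of the first \<open>t\<close> outputs on the item sequence \<open>us\<close>. Output number
  \<open>t + 1\<close> sees only \<open>take t us\<close>, the items revealed before it.\<close>

fun outputs :: "'v algorithm \<Rightarrow> 'v list \<Rightarrow> nat \<Rightarrow> 'v ranking list pmf" where
  "outputs A us 0 = return_pmf []"
| "outputs A us (Suc t) =
     bind_pmf (outputs A us t) (\<lambda>\<pi>s. map_pmf (\<lambda>\<pi>. \<pi>s @ [\<pi>]) (A (take t us) \<pi>s))"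

definition loss :: "'v ranking \<Rightarrow> 'v \<Rightarrow> real" where
  "loss \<pi> u = real (\<pi> u) - 1"

definition expected_loss :: "'v algorithm \<Rightarrow> 'v list \<Rightarrow> real" where
  "expected_loss A us =
     measure_pmf.expectation (outputs A us (length us)) (\<lambda>\<pi>s. \<Sum>t<length us. loss (\<pi>s ! t) (us ! t))"

definition best_fixed_loss :: "'v set \<Rightarrow> 'v list \<Rightarrow> real" where
  "best_fixed_loss V us = (MIN \<pi>\<in>rankings V. \<Sum>t<length us. loss \<pi> (us ! t))"

definition expected_regret :: "'v set \<Rightarrow> 'v algorithm \<Rightarrow> 'v list \<Rightarrow> real" where
  "expected_regret V A us = expected_loss A us - best_fixed_loss V us"

definition item_sequences :: "'v set \<Rightarrow> nat \<Rightarrow> 'v list set" where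
  "item_sequences V T = {us. set us \<subseteq> V \<and> length us = T}"

definition minimax_regret :: "'v set \<Rightarrow> nat \<Rightarrow> real" where
  "minimax_regret V T =
     (INF A\<in>online_algorithms V T. MAX us\<in>item_sequences V T. expected_regret V A us)"

end

theory Submission
  imports Defs
begin

text \<open>Draw the items independently and uniformly. Every algorithm then loses \<open>T (n - 1) / 2\<close> on
  average, whereas sorting the items by their numbers of occurrences \<open>N\<close> saves a quarter of
  \<open>\<Sum>a b. \<bar>N a - N b\<bar>\<close> against that value. Each \<open>N a - N b\<close> is a sum of \<open>T\<close> independent symmetric
  variables, so comparing its second and fourth moments shows that its mean absolute value is at
  least half its standard deviation \<open>\<surd>(2 T / n)\<close>.\<close>

section \<open>Averages over uniformly random item sequences\<close>

text \<open>Expectation over \<open>T\<close> independent uniform items, written as a finite sum;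
  there are \<open>card V ^ T\<close> sequences.\<close>

definition seq_avg :: "'v set \<Rightarrow> nat \<Rightarrow> ('v list \<Rightarrow> real) \<Rightarrow> real" where
  "seq_avg V T f = (\<Sum>us\<in>item_sequences V T. f us) / real (card V) ^ T"

lemma finite_item_sequences: "finite V \<Longrightarrow> finite (item_sequences V T)"
  unfolding item_sequences_def by (rule finite_lists_length_eq)

lemma card_item_sequences: "finite V \<Longrightarrow> card (item_sequences V T) = card V ^ T"
  unfolding item_sequences_def by (rule card_lists_length_eq)

lemma item_sequences_0 [simp]: "item_sequences V 0 = {[]}"
  by (auto simp: item_sequences_def)

lemma sum_item_sequences_Suc:
  assumes "finite V"
  shows "(\<Sum>us\<in>item_sequences V (Suc T). f us) = (\<Sum>us\<in>item_sequences V T. \<Sum>v\<in>V. f (us @ [v]))"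
proof -
  have "(\<Sum>us\<in>item_sequences V T. \<Sum>v\<in>V. f (us @ [v])) =
      (\<Sum>(us, v)\<in>item_sequences V T \<times> V. f (us @ [v]))"
    by (rule sum.cartesian_product)
  also have "\<dots> = (\<Sum>us\<in>item_sequences V (Suc T). f us)"
  proof (rule sum.reindex_bij_witness[of _ "\<lambda>us. (butlast us, last us)" "\<lambda>(us, v). us @ [v]"])
    fix us assume us: "us \<in> item_sequences V (Suc T)"
    then have ne: "us \<noteq> []" by (auto simp: item_sequences_def)
    then show "(case (butlast us, last us) of (us, v) \<Rightarrow> us @ [v]) = us" by simp
    show "(butlast us, last us) \<in> item_sequences V T \<times> V"
      using us ne by (auto simp: item_sequences_def dest: in_set_butlastD)
  qed (auto simp: item_sequences_def)
  finally show ?thesis ..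
qed

lemma seq_avg_0 [simp]: "seq_avg V 0 f = f []"
  by (simp add: seq_avg_def)

text \<open>Conditioning on the first \<open>T\<close> items. The new item is appended at the end,
  in the order in which an algorithm sees it; the inductions on \<open>T\<close> below all rest on
  this step.\<close>

lemma seq_avg_Suc:
  assumes "finite V"
  shows "seq_avg V (Suc T) f = seq_avg V T (\<lambda>us. (\<Sum>v\<in>V. f (us @ [v])) / card V)"
  by (simp add: seq_avg_def sum_item_sequences_Suc[OF assms] sum_divide_distrib[symmetric] mult.commute)

lemma seq_avg_cong:
  "(\<And>us. us \<in> item_sequences V T \<Longrightarrow> f us = g us) \<Longrightarrow> seq_avg V T f = seq_avg V T g"
  by (simp add: seq_avg_def)

lemma seq_avg_mono:
  "(\<And>us. us \<in> item_sequences V T \<Longrightarrow> f us \<le> g us) \<Longrightarrow> seq_avg V T f \<le> seq_avg V T g"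
  unfolding seq_avg_def by (intro divide_right_mono sum_mono) auto

lemma seq_avg_add: "seq_avg V T (\<lambda>us. f us + g us) = seq_avg V T f + seq_avg V T g"
  by (simp add: seq_avg_def sum.distrib add_divide_distrib)

lemma seq_avg_diff: "seq_avg V T (\<lambda>us. f us - g us) = seq_avg V T f - seq_avg V T g"
  by (simp add: seq_avg_def sum_subtractf diff_divide_distrib)

lemma seq_avg_cmult: "seq_avg V T (\<lambda>us. c * f us) = c * seq_avg V T f"
  by (simp add: seq_avg_def sum_distrib_left[symmetric])

lemma seq_avg_sum: "seq_avg V T (\<lambda>us. \<Sum>i\<in>I. f i us) = (\<Sum>i\<in>I. seq_avg V T (f i))"
  unfolding seq_avg_def by (subst sum.swap) (simp add: sum_divide_distrib)

lemma seq_avg_const: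
  assumes "finite V" "V \<noteq> {}"
  shows "seq_avg V T (\<lambda>_. c) = c"
  using assms by (simp add: seq_avg_def card_item_sequences)

text \<open>Turns a bound on the average regret into one bad sequence for the given
  algorithm.\<close>

lemma ex_ge_seq_avg:
  assumes "finite V" "V \<noteq> {}"
  shows "\<exists>us\<in>item_sequences V T. seq_avg V T f \<le> f us"
proof (rule ccontr)
  assume "\<not> ?thesis"
  then have less: "f us < seq_avg V T f" if "us \<in> item_sequences V T" for us
    using that by (auto simp: not_le)
  have "item_sequences V T \<noteq> {}"
    using assms card_item_sequences[of V T] by auto
  then have "(\<Sum>us\<in>item_sequences V T. f us) < (\<Sum>us\<in>item_sequences V T. seq_avg V T f)"
    using less finite_item_sequences[OF assms(1)] by (intro sum_strict_mono) auto
  also have "\<dots> = real (card V) ^ T * seq_avg V T f"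
    by (simp add: card_item_sequences[OF assms(1)])
  also have "\<dots> = (\<Sum>us\<in>item_sequences V T. f us)"
    using assms by (simp add: seq_avg_def)
  finally show False by simp
qed

section \<open>Moments of the difference of two counts\<close>

text \<open>The steps \<open>x v\<close> have mean zero, so the cross term averages out and each new
  item adds exactly \<open>m\<close>.\<close>

lemma seq_avg_sum_list_square:
  fixes x :: "'v \<Rightarrow> real"
  assumes "finite V" "V \<noteq> {}" and x: "(\<Sum>v\<in>V. x v) = 0"
  defines "m \<equiv> (\<Sum>v\<in>V. x v ^ 2) / card V"
  shows "seq_avg V T (\<lambda>us. sum_list (map x us) ^ 2) = T * m"
proof (induction T)
  case (Suc T)
  have "(\<Sum>v\<in>V. (y + x v) ^ 2) / card V = y ^ 2 + m" for y
  proof -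
    have "(\<Sum>v\<in>V. (y + x v) ^ 2) = (\<Sum>v\<in>V. y ^ 2 + 2 * y * x v + x v ^ 2)"
      by (simp add: power2_sum add_ac)
    also have "\<dots> = card V * y ^ 2 + (\<Sum>v\<in>V. x v ^ 2)"
      by (simp add: sum.distrib sum_distrib_left[symmetric] x)
    finally show ?thesis
      using assms(1,2) by (simp add: m_def field_simps)
  qed
  then have "seq_avg V (Suc T) (\<lambda>us. sum_list (map x us) ^ 2) =
      seq_avg V T (\<lambda>us. sum_list (map x us) ^ 2 + m)"
    by (simp add: seq_avg_Suc[OF assms(1)])
  also have "\<dots> = Suc T * m"
    unfolding seq_avg_add seq_avg_const[OF assms(1,2)] Suc by (simp add: algebra_simps)
  finally show ?case .
qed simp

text \<open>The first and third moments of a step vanish, so only even terms of the binomial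
  expansion survive. The exact value has \<open>T * (T - 1)\<close> in place of
  \<open>T ^ 2\<close>; the relaxed form is simpler and strong enough.\<close>

lemma seq_avg_sum_list_power4:
  fixes x :: "'v \<Rightarrow> real"
  assumes "finite V" "V \<noteq> {}" and x: "(\<Sum>v\<in>V. x v) = 0" "(\<Sum>v\<in>V. x v ^ 3) = 0"
  defines "m \<equiv> (\<Sum>v\<in>V. x v ^ 2) / card V"
  defines "k \<equiv> (\<Sum>v\<in>V. x v ^ 4) / card V"
  shows "seq_avg V T (\<lambda>us. sum_list (map x us) ^ 4) \<le> 3 * real T ^ 2 * m ^ 2 + T * k"
proof (induction T)
  case (Suc T)
  have "(\<Sum>v\<in>V. (y + x v) ^ 4) / card V = y ^ 4 + (6 * m) * y ^ 2 + k" for y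
  proof -
    have "(\<Sum>v\<in>V. (y + x v) ^ 4) =
        (\<Sum>v\<in>V. y ^ 4 + 4 * y ^ 3 * x v + 6 * y ^ 2 * x v ^ 2 + 4 * y * x v ^ 3 + x v ^ 4)"
      by (intro sum.cong refl) (simp add: algebra_simps power2_eq_square power3_eq_cube power4_eq_xxxx)
    also have "\<dots> = card V * y ^ 4 + 6 * y ^ 2 * (\<Sum>v\<in>V. x v ^ 2) + (\<Sum>v\<in>V. x v ^ 4)"
      by (simp add: sum.distrib sum_distrib_left[symmetric] x)
    finally show ?thesis
      using assms(1,2) by (simp add: m_def k_def field_simps)
  qed
  then have "seq_avg V (Suc T) (\<lambda>us. sum_list (map x us) ^ 4) =
      seq_avg V T (\<lambda>us. sum_list (map x us) ^ 4 + (6 * m) * sum_list (map x us) ^ 2 + k)"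
    by (simp add: seq_avg_Suc[OF assms(1)])
  also have "\<dots> = seq_avg V T (\<lambda>us. sum_list (map x us) ^ 4) + 6 * m * (T * m) + k"
    unfolding seq_avg_add seq_avg_cmult seq_avg_const[OF assms(1,2)]
      seq_avg_sum_list_square[OF assms(1,2) x(1)] m_def by simp
  \<comment> \<open>The slack \<open>3 * m ^ 2\<close> completes the square
    \<open>3 * (T + 1) ^ 2 * m ^ 2\<close>.\<close>
  also have "\<dots> \<le> 3 * real T ^ 2 * m ^ 2 + T * k + 6 * m * (T * m) + k + 3 * m ^ 2"
    using Suc zero_le_power2[of m] by linarith
  also have "\<dots> = 3 * real (Suc T) ^ 2 * m ^ 2 + Suc T * k"
    by (simp add: algebra_simps power2_eq_square)
  finally show ?case by simp
qed simp

text \<open>A minorant of the absolute value whose average needs only the second and fourth moments.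
  It touches \<open>\<bar>y\<bar>\<close> at 0 and at plus or minus \<open>2 * s\<close>. A variable
  on these three points with second moment \<open>s^2\<close> and fourth moment
  \<open>4 * s^4\<close> has mean absolute value \<open>s / 2\<close>, so no better constant follows
  from these two moments.\<close>

lemma abs_ge_even_powers:
  fixes y s :: real
  assumes "s > 0"
  shows "(12 * s\<^sup>2 * y\<^sup>2 - y ^ 4) / (16 * s ^ 3) \<le> \<bar>y\<bar>"
proof -
  \<comment> \<open>The cubic \<open>z^3 - 12 s^2 z + 16 s^3\<close> has the double root
    \<open>2 s\<close> and the simple root \<open>-4 s\<close>.\<close>
  have "0 \<le> \<bar>y\<bar> * (\<bar>y\<bar> - 2 * s)\<^sup>2 * (\<bar>y\<bar> + 4 * s)"
    using assms by (intro mult_nonneg_nonneg) auto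
  also have "\<dots> = \<bar>y\<bar> ^ 4 - 12 * s\<^sup>2 * \<bar>y\<bar>\<^sup>2 + 16 * s ^ 3 * \<bar>y\<bar>"
    by (simp add: algebra_simps power2_eq_square power3_eq_cube power4_eq_xxxx)
  finally show ?thesis
    using assms by (simp add: field_simps)
qed

lemma seq_avg_abs_count_diff:
  assumes "finite V" "a \<in> V" "b \<in> V" "a \<noteq> b" and T: "card V \<le> T"
  shows "sqrt (2 * real T / card V) / 2 \<le>
    seq_avg V T (\<lambda>us. \<bar>real (count_list us a) - real (count_list us b)\<bar>)"
proof -
  define x :: "'a \<Rightarrow> real" where "x v = of_bool (v = a) - of_bool (v = b)" for v
  define s where "s = sqrt (2 * real T / card V)"
  have ne: "V \<noteq> {}" using assms by auto
  have card: "card V > 0" using assms(1) ne by (simp add: card_gt_0_iff)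
  have count: "real (count_list us a) - real (count_list us b) = sum_list (map x us)" for us
    by (induction us) (auto simp: x_def)
  have pow: "x v ^ i = of_bool (v = a) + (-1) ^ i * of_bool (v = b)" if "i > 0" for i v
    using that assms(4) by (auto simp: x_def)
  \<comment> \<open>Only \<open>a\<close> and \<open>b\<close> contribute: odd powers cancel and
    even powers sum to 2. This supplies all the moments required of \<open>x\<close>.\<close>
  have sum_pow: "(\<Sum>v\<in>V. x v ^ i) = 1 + (-1) ^ i" if "i > 0" for i
    using assms(1-3) by (simp add: pow[OF that] sum.distrib sum_distrib_left[symmetric] of_bool_def)
  have sum1: "(\<Sum>v\<in>V. x v) = 0" using sum_pow[of 1] by simp
  have s: "s > 0" using card T by (simp add: s_def)
  have s2: "s\<^sup>2 = 2 * T / card V" by (simp add: s_def)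
  \<comment> \<open>The only use of \<open>card V \<le> T\<close>: it gives
    \<open>s^2 \<ge> 1\<close>, so the lower order term \<open>s^2\<close> of the fourth moment is
    absorbed into \<open>s^4\<close>.\<close>
  have "1 \<le> real T / card V" using T card by simp
  then have s2_ge: "s\<^sup>2 \<ge> 1" by (simp add: s2)
  have m2: "seq_avg V T (\<lambda>us. sum_list (map x us) ^ 2) = s\<^sup>2"
    using seq_avg_sum_list_square[OF assms(1) ne sum1, of T] sum_pow[of 2] by (simp add: s2)
  have "seq_avg V T (\<lambda>us. sum_list (map x us) ^ 4) \<le>
      3 * real T ^ 2 * (2 / card V) ^ 2 + T * (2 / card V)"
    using seq_avg_sum_list_power4[OF assms(1) ne sum1, of T] sum_pow[of 2] sum_pow[of 3] sum_pow[of 4]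
    by simp
  also have "\<dots> = 3 * (s\<^sup>2)\<^sup>2 + s\<^sup>2"
    by (simp add: s2 power_divide power_mult_distrib)
  also have "\<dots> \<le> 4 * (s\<^sup>2)\<^sup>2"
    using self_le_power[OF s2_ge, of 2] by simp
  finally have m4: "seq_avg V T (\<lambda>us. sum_list (map x us) ^ 4) \<le> 4 * s ^ 4" by simp
  \<comment> \<open>The average of the minorant at the moments \<open>s^2\<close> and
    \<open>4 * s^4\<close>: (12 - 4) / 16 = 1/2.\<close>
  have "s / 2 = (12 * s\<^sup>2 * s\<^sup>2 - 4 * s ^ 4) / (16 * s ^ 3)"
    using s by (simp add: field_simps power2_eq_square power3_eq_cube power4_eq_xxxx)
  also have "\<dots> \<le> (12 * s\<^sup>2 * s\<^sup>2 - seq_avg V T (\<lambda>us. sum_list (map x us) ^ 4)) / (16 * s ^ 3)"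
    using m4 s by (intro divide_right_mono) auto
  also have "\<dots> = seq_avg V T (\<lambda>us. 1 / (16 * s ^ 3) * (12 * s\<^sup>2 * (sum_list (map x us))\<^sup>2 - sum_list (map x us) ^ 4))"
    by (simp only: seq_avg_cmult seq_avg_diff m2) simp
  also have "\<dots> \<le> seq_avg V T (\<lambda>us. \<bar>sum_list (map x us)\<bar>)"
    using abs_ge_even_powers[OF s] by (intro seq_avg_mono) simp
  finally show ?thesis by (simp add: count s_def)
qed

section \<open>The best fixed ranking\<close>

lemma finite_rankings:
  assumes "finite V"
  shows "finite (rankings V)"
proof (rule finite_subset)
  show "rankings V \<subseteq> V \<rightarrow>\<^sub>E {1..card V}"
    by (auto simp: rankings_def PiE_def bij_betw_def)
qed (use assms in \<open>simp add: finite_PiE\<close>)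

text \<open>Every position is used once, so the losses are 0, ..., n - 1 in some order. Hence a
  uniform item costs (n - 1) / 2 on average under any ranking.\<close>

lemma sum_loss_ranking:
  assumes "\<pi> \<in> rankings V"
  shows "(\<Sum>v\<in>V. loss \<pi> v) = real (card V) * (real (card V) - 1) / 2"
proof -
  have "(\<Sum>v\<in>V. loss \<pi> v) = (\<Sum>i\<in>{1..card V}. real i - 1)"
    using sum.reindex_bij_betw[of \<pi> V "{1..card V}" "\<lambda>i. real i - 1"] assms
    by (simp add: loss_def rankings_def)
  also have "(\<Sum>i\<in>{1..n}. real i - 1) = real n * (real n - 1) / 2" for n
    by (induction n) (auto simp: field_simps)
  finally show ?thesis .
qed

text \<open>The loss of an item counts the items ahead of it, so sorting by decreasing
  \<open>N\<close> makes each unordered pair pay min(N a, N b) = (N a + N b) / 2 - \<bar>N a - N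
  b\<bar> / 2. Summing over pairs gives the formula; the double sum meets each pair twice, hence the
  quarter. The induction adds items in order of decreasing \<open>N\<close>.\<close>

lemma ex_sorting_ranking:
  fixes N :: "'v \<Rightarrow> real"
  assumes "finite V"
  shows "\<exists>\<pi>\<in>rankings V. (\<Sum>v\<in>V. N v * loss \<pi> v) =
    (real (card V) - 1) / 2 * (\<Sum>v\<in>V. N v) - (\<Sum>a\<in>V. \<Sum>b\<in>V. \<bar>N a - N b\<bar>) / 4"
  using assms
proof (induction V rule: finite_ranking_induct[where f = "\<lambda>v. - N v"])
  case empty
  show ?case by (auto simp: rankings_def bij_betw_def)
next
  case (insert x S)
  show ?case
  \<comment> \<open>The induction rule only says that \<open>N x\<close> is at most every
    \<open>N y\<close> with \<open>y\<close> in \<open>S\<close>; \<open>x\<close> may already lie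
    in \<open>S\<close>.\<close>
  proof (cases "x \<in> S")
    case True
    then show ?thesis using insert.IH by (simp add: insert_absorb)
  next
    case False
    obtain \<pi> where \<pi>: "\<pi> \<in> rankings S" and eq: "(\<Sum>v\<in>S. N v * loss \<pi> v) =
        (real (card S) - 1) / 2 * (\<Sum>v\<in>S. N v) - (\<Sum>a\<in>S. \<Sum>b\<in>S. \<bar>N a - N b\<bar>) / 4"
      using insert.IH by blast
    \<comment> \<open>The new item has the smallest \<open>N\<close> so far and takes the last
      position, with loss \<open>card S\<close>.\<close>
    define \<pi>' where "\<pi>' = \<pi>(x := Suc (card S))"
    have "bij_betw \<pi>' ({x} \<union> S) ({Suc (card S)} \<union> {1..card S})"
    proof (rule bij_betw_combine)
      show "bij_betw \<pi>' {x} {Suc (card S)}" by (simp add: \<pi>'_def bij_betw_def)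
      have "bij_betw \<pi> S {1..card S}" using \<pi> by (simp add: rankings_def)
      then show "bij_betw \<pi>' S {1..card S}"
        using False by (subst bij_betw_cong[of S _ \<pi>]) (auto simp: \<pi>'_def)
    qed auto
    moreover have "{Suc (card S)} \<union> {1..card S} = {1..card (insert x S)}"
      using insert.hyps False by auto
    moreover have "\<pi>' \<in> extensional (insert x S)"
      using \<pi> by (auto simp: \<pi>'_def rankings_def extensional_def)
    ultimately have "\<pi>' \<in> rankings (insert x S)" by (simp add: rankings_def)
    moreover have "(\<Sum>v\<in>insert x S. N v * loss \<pi>' v) =
      (real (card (insert x S)) - 1) / 2 * (\<Sum>v\<in>insert x S. N v)
        - (\<Sum>a\<in>insert x S. \<Sum>b\<in>insert x S. \<bar>N a - N b\<bar>) / 4"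
    proof -
      have "(\<Sum>v\<in>S. N v * loss \<pi>' v) = (\<Sum>v\<in>S. N v * loss \<pi> v)"
        using False by (intro sum.cong) (auto simp: \<pi>'_def loss_def)
      then have lhs: "(\<Sum>v\<in>insert x S. N v * loss \<pi>' v) = N x * card S + (\<Sum>v\<in>S. N v * loss \<pi> v)"
        using insert.hyps(1) False by (simp add: \<pi>'_def loss_def)
      \<comment> \<open>Minimality of \<open>N x\<close> opens all these absolute values with the
        same sign.\<close>
      have d: "(\<Sum>a\<in>S. \<bar>N a - N x\<bar>) = (\<Sum>a\<in>S. N a) - card S * N x"
      proof -
        have "(\<Sum>a\<in>S. \<bar>N a - N x\<bar>) = (\<Sum>a\<in>S. N a - N x)"
          using insert.hyps by (intro sum.cong) auto
        then show ?thesis by (simp add: sum_subtractf)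
      qed
      have d': "(\<Sum>a\<in>S. \<bar>N x - N a\<bar>) = (\<Sum>a\<in>S. N a) - card S * N x"
        using d by (simp add: abs_minus_commute)
      show ?thesis
        unfolding lhs eq using insert.hyps(1) False
        by (simp add: sum.distrib d d' field_simps)
    qed
    ultimately show ?thesis by blast
  qed
qed

lemma rankings_nonempty: "finite V \<Longrightarrow> rankings V \<noteq> {}"
  using ex_sorting_ranking[of V] by auto

text \<open>Regrouping by item: the total loss of a fixed ranking depends only on the
  counts.\<close>

lemma sum_nth_count_list:
  fixes f :: "'v \<Rightarrow> real"
  assumes "finite V" "set us \<subseteq> V"
  shows "(\<Sum>t<length us. f (us ! t)) = (\<Sum>v\<in>V. real (count_list us v) * f v)"
proof -
  have "(\<Sum>t<length us. f (us ! t)) = sum_list (map f us)"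
    by (simp add: sum_list_sum_nth atLeast0LessThan)
  also have "\<dots> = (\<Sum>v\<in>V. real (count_list us v) * f v)"
    using assms(2)
  proof (induction us)
    case (Cons u us)
    have "(\<Sum>v\<in>V. real (count_list (u # us) v) * f v) =
        (\<Sum>v\<in>V. real (count_list us v) * f v + (if v = u then f v else 0))"
      by (intro sum.cong) (auto simp: algebra_simps)
    then show ?case
      using Cons assms(1) by (simp add: sum.distrib sum.delta)
  qed simp
  finally show ?thesis .
qed

text \<open>The sorting ranking is one competitor. An upper bound suffices for a lower bound on
  regret, so sorting need not be shown optimal.\<close>

lemma best_fixed_loss_le:
  assumes "finite V" "us \<in> item_sequences V T"
  shows "best_fixed_loss V us \<le> real T * (real (card V) - 1) / 2
    - (\<Sum>a\<in>V. \<Sum>b\<in>V. \<bar>real (count_list us a) - real (count_list us b)\<bar>) / 4"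
proof -
  define N where "N v = real (count_list us v)" for v
  have us: "set us \<subseteq> V" "length us = T"
    using assms(2) by (auto simp: item_sequences_def)
  obtain \<pi> where \<pi>: "\<pi> \<in> rankings V" and eq: "(\<Sum>v\<in>V. N v * loss \<pi> v) =
      (real (card V) - 1) / 2 * (\<Sum>v\<in>V. N v) - (\<Sum>a\<in>V. \<Sum>b\<in>V. \<bar>N a - N b\<bar>) / 4"
    using ex_sorting_ranking[OF assms(1)] by blast
  have "(\<Sum>v\<in>V. N v) = real T"
    using sum_nth_count_list[OF assms(1) us(1), of "\<lambda>_. 1"] us(2) by (simp add: N_def)
  moreover have "best_fixed_loss V us \<le> (\<Sum>t<length us. loss \<pi> (us ! t))"
    unfolding best_fixed_loss_def using finite_rankings[OF assms(1)] \<pi> by (intro Min_le) auto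
  ultimately show ?thesis
    using sum_nth_count_list[OF assms(1) us(1), of "loss \<pi>"] eq by (simp add: N_def mult.commute)
qed

section \<open>The average loss of an algorithm\<close>

lemma online_algorithms_Suc: "A \<in> online_algorithms V (Suc T) \<Longrightarrow> A \<in> online_algorithms V T"
  by (simp add: online_algorithms_def)

text \<open>No output looks ahead, so appending an item leaves the distribution of the earlier
  outputs unchanged.\<close>

lemma outputs_cong: "take t us = take t us' \<Longrightarrow> outputs A us t = outputs A us' t"
proof (induction t)
  case (Suc t)
  have "take t us = take t us'"
    using arg_cong[OF Suc.prems, of "take t"] by simp
  then show ?case using Suc.IH by simp
qed simp

text \<open>\<open>online_algorithms\<close> constrains an algorithm only on valid histories, so
  validity is propagated round by round. For finite \<open>V\<close> this also confines the outputs
  to a finite set, which turns expectations into finite sums.\<close>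

lemma set_pmf_outputs:
  assumes "A \<in> online_algorithms V T" "set us \<subseteq> V" "t \<le> T" "t \<le> length us"
  shows "set_pmf (outputs A us t) \<subseteq> {\<pi>s. set \<pi>s \<subseteq> rankings V \<and> length \<pi>s = t}"
  using assms(3,4)
proof (induction t)
  case (Suc t)
  have "set (take t us) \<subseteq> V" using assms(2) by (auto dest: in_set_takeD)
  moreover have "length (take t us) = t" "t < T" using Suc.prems by auto
  ultimately have "set_pmf (A (take t us) \<pi>s) \<subseteq> rankings V"
    if "set \<pi>s \<subseteq> rankings V" "length \<pi>s = t" for \<pi>s
    using assms(1) that by (simp add: online_algorithms_def)
  moreover have "set_pmf (outputs A us t) \<subseteq> {\<pi>s. set \<pi>s \<subseteq> rankings V \<and> length \<pi>s = t}"
    using Suc by simp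
  ultimately show ?case by fastforce
qed simp

text \<open>The last ranking is drawn from \<open>A us \<pi>s\<close> before \<open>v\<close> is
  revealed; in the added term \<open>v\<close> occurs only inside the loss.\<close>

lemma expected_loss_snoc:
  assumes A: "A \<in> online_algorithms V (Suc T)" and "finite V"
    and us: "us \<in> item_sequences V T" and v: "v \<in> V"
  defines "S \<equiv> {\<pi>s. set \<pi>s \<subseteq> rankings V \<and> length \<pi>s = T}"
  shows "expected_loss A (us @ [v]) = expected_loss A us +
    (\<Sum>\<pi>s\<in>S. pmf (outputs A us T) \<pi>s * measure_pmf.expectation (A us \<pi>s) (\<lambda>\<pi>. loss \<pi> v))"
proof -
  have len: "length us = T" and sub: "set us \<subseteq> V" using us by (auto simp: item_sequences_def)
  have S: "finite S" unfolding S_def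
    using finite_lists_length_eq[OF finite_rankings[OF assms(2)]] by simp
  have supp: "set_pmf (outputs A us T) \<subseteq> S"
    unfolding S_def using set_pmf_outputs[OF online_algorithms_Suc[OF A] sub] len by simp
  have A_supp: "set_pmf (A us \<pi>s) \<subseteq> rankings V" if "\<pi>s \<in> S" for \<pi>s
    using A that sub len by (auto simp: online_algorithms_def S_def)
  have fin: "finite (set_pmf (A us \<pi>s))" if "\<pi>s \<in> S" for \<pi>s
    using A_supp[OF that] finite_rankings[OF assms(2)] finite_subset by blast
  have out: "outputs A (us @ [v]) T = outputs A us T"
    using len by (intro outputs_cong) simp
  have "expected_loss A (us @ [v]) = measure_pmf.expectation
      (bind_pmf (outputs A us T) (\<lambda>\<pi>s. map_pmf (\<lambda>\<pi>. \<pi>s @ [\<pi>]) (A us \<pi>s)))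
      (\<lambda>\<pi>s. \<Sum>t<Suc T. loss (\<pi>s ! t) ((us @ [v]) ! t))"
    using len by (simp add: expected_loss_def out)
  also have "\<dots> = (\<Sum>\<pi>s\<in>S. pmf (outputs A us T) \<pi>s *
      measure_pmf.expectation (A us \<pi>s) (\<lambda>\<pi>. \<Sum>t<Suc T. loss ((\<pi>s @ [\<pi>]) ! t) ((us @ [v]) ! t)))"
    using S supp fin by (subst pmf_expectation_bind[where A = S]) auto
  also have "\<dots> = (\<Sum>\<pi>s\<in>S. pmf (outputs A us T) \<pi>s *
      ((\<Sum>t<length us. loss (\<pi>s ! t) (us ! t)) + measure_pmf.expectation (A us \<pi>s) (\<lambda>\<pi>. loss \<pi> v)))"
  proof (intro sum.cong refl arg_cong2[of _ _ _ _ "(*)"])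
    fix \<pi>s assume "\<pi>s \<in> S"
    then have "(\<Sum>t<Suc T. loss ((\<pi>s @ [\<pi>]) ! t) ((us @ [v]) ! t)) =
        (\<Sum>t<length us. loss (\<pi>s ! t) (us ! t)) + loss \<pi> v" for \<pi>
      using len by (auto simp: S_def nth_append intro!: sum.cong)
    then show "measure_pmf.expectation (A us \<pi>s)
          (\<lambda>\<pi>. \<Sum>t<Suc T. loss ((\<pi>s @ [\<pi>]) ! t) ((us @ [v]) ! t)) =
        (\<Sum>t<length us. loss (\<pi>s ! t) (us ! t)) + measure_pmf.expectation (A us \<pi>s) (\<lambda>\<pi>. loss \<pi> v)"
      by (simp add: integrable_measure_pmf_finite[OF fin[OF \<open>\<pi>s \<in> S\<close>]])
  qed
  also have "\<dots> = expected_loss A us +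
      (\<Sum>\<pi>s\<in>S. pmf (outputs A us T) \<pi>s * measure_pmf.expectation (A us \<pi>s) (\<lambda>\<pi>. loss \<pi> v))"
    using integral_measure_pmf_real[OF S, of "outputs A us T"] supp
    by (auto simp: expected_loss_def len distrib_left sum.distrib mult.commute subset_iff)
  finally show ?thesis .
qed

text \<open>For each history the losses of the last ranking sum over \<open>v\<close> to n (n - 1) /
  2, whatever the algorithm does; the weights of the histories sum to 1.\<close>

lemma sum_expected_loss_snoc:
  assumes A: "A \<in> online_algorithms V (Suc T)" and V: "finite V"
    and us: "us \<in> item_sequences V T"
  shows "(\<Sum>v\<in>V. expected_loss A (us @ [v])) =
    card V * (expected_loss A us + (real (card V) - 1) / 2)"
proof -
  define S where "S = {\<pi>s. set \<pi>s \<subseteq> rankings V \<and> length \<pi>s = T}"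
  have len: "length us = T" and sub: "set us \<subseteq> V" using us by (auto simp: item_sequences_def)
  have S: "finite S" unfolding S_def
    using finite_lists_length_eq[OF finite_rankings[OF V]] by simp
  have supp: "set_pmf (outputs A us T) \<subseteq> S"
    unfolding S_def using set_pmf_outputs[OF online_algorithms_Suc[OF A] sub] len by simp
  have step: "(\<Sum>v\<in>V. measure_pmf.expectation (A us \<pi>s) (\<lambda>\<pi>. loss \<pi> v)) =
      real (card V) * (real (card V) - 1) / 2" if "\<pi>s \<in> S" for \<pi>s
  proof -
    have rk: "set_pmf (A us \<pi>s) \<subseteq> rankings V"
      using A that sub len by (auto simp: online_algorithms_def S_def)
    then have fin: "finite (set_pmf (A us \<pi>s))"
      using finite_rankings[OF V] finite_subset by blast
    have "(\<Sum>v\<in>V. measure_pmf.expectation (A us \<pi>s) (\<lambda>\<pi>. loss \<pi> v)) =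
        measure_pmf.expectation (A us \<pi>s) (\<lambda>\<pi>. \<Sum>v\<in>V. loss \<pi> v)"
      using integrable_measure_pmf_finite[OF fin] by (subst Bochner_Integration.integral_sum) auto
    also have "\<dots> = measure_pmf.expectation (A us \<pi>s) (\<lambda>_. real (card V) * (real (card V) - 1) / 2)"
      using rk sum_loss_ranking by (intro integral_cong_AE) (auto simp: AE_measure_pmf_iff)
    finally show ?thesis by simp
  qed
  have "(\<Sum>v\<in>V. expected_loss A (us @ [v])) = card V * expected_loss A us +
     (\<Sum>v\<in>V. \<Sum>\<pi>s\<in>S. pmf (outputs A us T) \<pi>s * measure_pmf.expectation (A us \<pi>s) (\<lambda>\<pi>. loss \<pi> v))"
    using expected_loss_snoc[OF A V us] by (simp add: S_def sum.distrib)
  also have "(\<Sum>v\<in>V. \<Sum>\<pi>s\<in>S. pmf (outputs A us T) \<pi>s * measure_pmf.expectation (A us \<pi>s) (\<lambda>\<pi>. loss \<pi> v)) =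
      (\<Sum>\<pi>s\<in>S. pmf (outputs A us T) \<pi>s * (real (card V) * (real (card V) - 1) / 2))"
    by (subst sum.swap) (simp add: sum_distrib_left[symmetric] step)
  also have "\<dots> = real (card V) * (real (card V) - 1) / 2"
    unfolding sum_distrib_right[symmetric] using sum_pmf_eq_1[OF S supp] by simp
  finally show ?thesis by (simp add: algebra_simps)
qed

text \<open>Past items tell nothing about the next uniform one, so each round costs (n - 1) / 2 on
  average.\<close>

lemma seq_avg_expected_loss:
  assumes "finite V" "V \<noteq> {}" "A \<in> online_algorithms V T"
  shows "seq_avg V T (expected_loss A) = real T * (real (card V) - 1) / 2"
  using assms(3)
proof (induction T)
  case 0
  then show ?case by (simp add: expected_loss_def)
next
  case (Suc T)
  have "seq_avg V (Suc T) (expected_loss A) =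
      seq_avg V T (\<lambda>us. expected_loss A us + (real (card V) - 1) / 2)"
    unfolding seq_avg_Suc[OF assms(1)]
    using assms(1,2) sum_expected_loss_snoc[OF Suc.prems assms(1)] by (intro seq_avg_cong) simp
  also have "\<dots> = real (Suc T) * (real (card V) - 1) / 2"
    unfolding seq_avg_add seq_avg_const[OF assms(1,2)]
      Suc.IH[OF online_algorithms_Suc[OF Suc.prems]] by (simp add: field_simps)
  finally show ?case .
qed

section \<open>The regret bound\<close>

text \<open>There are n (n - 1) ordered pairs of distinct items, each with mean absolute difference
  at least half the standard deviation; the quarter from sorting makes this 1/8.\<close>

lemma seq_avg_expected_regret:
  assumes "finite V" "V \<noteq> {}" "A \<in> online_algorithms V T" "card V \<le> T"
  shows "real (card V) * (real (card V) - 1) / 8 * sqrt (2 * real T / card V) \<le>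
    seq_avg V T (expected_regret V A)"
proof -
  define D where "D us a b = \<bar>real (count_list us a) - real (count_list us b)\<bar>" for us :: "'a list" and a b
  define s where "s = sqrt (2 * real T / card V) / 2"
  \<comment> \<open>Diagonal pairs are set to 0, since the bound on count differences holds only for
    distinct items.\<close>
  have "real (card V) * (real (card V) - 1) * s = (\<Sum>a\<in>V. \<Sum>b\<in>V. if b = a then 0 else s)"
  proof -
    have "(\<Sum>b\<in>V. if b = a then 0 else s) = (real (card V) - 1) * s" if "a \<in> V" for a
    proof -
      have "(\<Sum>b\<in>V. if b = a then 0 else s) = (\<Sum>b\<in>V. s - (if b = a then s else 0))"
        by (intro sum.cong) auto
      then show ?thesis
        using that assms(1) by (simp add: sum_subtractf algebra_simps)
    qed
    then show ?thesis by simp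
  qed
  also have "\<dots> \<le> (\<Sum>a\<in>V. \<Sum>b\<in>V. seq_avg V T (\<lambda>us. D us a b))"
  proof (intro sum_mono)
    fix a b assume "a \<in> V" "b \<in> V"
    then show "(if b = a then 0 else s) \<le> seq_avg V T (\<lambda>us. D us a b)"
      using seq_avg_abs_count_diff[OF assms(1) _ _ _ assms(4), of a b] seq_avg_const[OF assms(1,2), of T 0]
      by (auto simp: D_def s_def)
  qed
  also have "\<dots> = 4 * (seq_avg V T (expected_loss A) - seq_avg V T (\<lambda>us.
      real T * (real (card V) - 1) / 2 - (1 / 4) * (\<Sum>a\<in>V. \<Sum>b\<in>V. D us a b)))"
    unfolding seq_avg_expected_loss[OF assms(1-3)] seq_avg_diff seq_avg_cmult seq_avg_sum
      seq_avg_const[OF assms(1,2)] by simp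
  also have "\<dots> \<le> 4 * (seq_avg V T (expected_loss A) - seq_avg V T (best_fixed_loss V))"
    using best_fixed_loss_le[OF assms(1)]
    by (intro mult_left_mono diff_left_mono seq_avg_mono) (auto simp: D_def)
  also have "\<dots> = 4 * seq_avg V T (expected_regret V A)"
    by (simp add: expected_regret_def[abs_def] seq_avg_diff)
  finally show ?thesis by (simp add: s_def)
qed

text \<open>With n - 1 \<ge> n / 2 and the factor \<open>sqrt 2\<close> dropped, the constant is
  still 1/16, well above 0.003.\<close>

lemma regret_bound_ge:
  fixes n T :: nat
  assumes "n \<ge> 2"
  shows "0.003 * real n powr (3/2) * sqrt (real T) \<le> real n * (real n - 1) / 8 * sqrt (2 * real T / n)"
proof -
  have n: "real n > 0" using assms by simp
  have "real n powr (3/2) = real n powr (1 + 1/2)" by simp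
  also have "\<dots> = real n * sqrt n" using n by (subst powr_add) (simp add: powr_half_sqrt)
  finally have pw: "real n powr (3/2) = real n * sqrt n" .
  have "0.003 * real n powr (3/2) * sqrt T \<le> real n / 16 * sqrt n * sqrt T"
    unfolding pw by (intro mult_right_mono) auto
  also have "\<dots> = real n * (real n / 2) / 8 * (sqrt T / sqrt n)"
    using n by (simp add: field_simps)
  also have "\<dots> \<le> real n * (real n - 1) / 8 * (sqrt T / sqrt n)"
    using assms by (intro mult_right_mono divide_right_mono mult_left_mono) auto
  also have "\<dots> \<le> real n * (real n - 1) / 8 * sqrt (2 * real T / n)"
    using assms by (intro mult_left_mono) (auto simp: real_sqrt_divide[symmetric] divide_right_mono)
  finally show ?thesis .
qed

theorem theorem3p3:
  "\<exists>(n0::nat) (h::nat \<Rightarrow> nat). \<forall>n\<ge>n0. \<forall>T\<ge>h n. \<forall>V::'v set. finite V \<and> card V = n \<longrightarrow>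
     (\<forall>A\<in>online_algorithms V T. \<exists>us\<in>item_sequences V T.
        expected_regret V A us \<ge> 0.003 * real n powr (3/2) * sqrt (real T)) \<and>
     minimax_regret V T \<ge> 0.003 * real n powr (3/2) * sqrt (real T)"
\<comment> \<open>\<open>n \<ge> 2\<close> serves the estimate n - 1 \<ge> n / 2, and
  \<open>T \<ge> n\<close> the fourth moment bound.\<close>
proof (rule exI[of _ 2], rule exI[of _ "\<lambda>n. n"], intro allI impI)
  fix n T :: nat and V :: "'v set"
  assume n: "2 \<le> n" and T: "n \<le> T" and V: "finite V \<and> card V = n"
  then have fin: "finite V" and card: "card V = n" by auto
  define B where "B = 0.003 * real n powr (3/2) * sqrt (real T)"
  have ne: "V \<noteq> {}" using n V by auto
  have ex: "\<exists>us\<in>item_sequences V T. expected_regret V A us \<ge> B" if A: "A \<in> online_algorithms V T" for A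
  proof -
    obtain us where us: "us \<in> item_sequences V T"
        "seq_avg V T (expected_regret V A) \<le> expected_regret V A us"
      using ex_ge_seq_avg[of V T "expected_regret V A"] V ne by blast
    have "B \<le> seq_avg V T (expected_regret V A)"
      unfolding B_def
      using order_trans[OF regret_bound_ge[OF n] seq_avg_expected_regret[of V A T, unfolded card]]
        fin ne A T by blast
    then show ?thesis using us by force
  qed
  \<comment> \<open>A constant algorithm shows that the infimum ranges over a nonempty set, as
    \<open>cINF_greatest\<close> requires.\<close>
  obtain \<pi> where "\<pi> \<in> rankings V" using rankings_nonempty V by blast
  then have "(\<lambda>_ _. return_pmf \<pi>) \<in> online_algorithms V T"
    by (simp add: online_algorithms_def)
  then have "minimax_regret V T \<ge> B"
    unfolding minimax_regret_def
  proof (intro cINF_greatest)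
    fix A assume "A \<in> online_algorithms V T"
    then obtain us where "us \<in> item_sequences V T" "expected_regret V A us \<ge> B" using ex by blast
    then show "B \<le> (MAX us\<in>item_sequences V T. expected_regret V A us)"
      using finite_item_sequences[of V T] V by (subst Max_ge_iff) auto
  qed auto
  then show "(\<forall>A\<in>online_algorithms V T. \<exists>us\<in>item_sequences V T.
        expected_regret V A us \<ge> 0.003 * real n powr (3/2) * sqrt (real T)) \<and>
     minimax_regret V T \<ge> 0.003 * real n powr (3/2) * sqrt (real T)"
    using ex by (simp add: B_def)
qed

end
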